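(* Let $T>0$ and $\theta\in[0,\pi/2]$. Let $\lambda_k$, $k\in\mathbb N=\{1,2,\dots\}$, be the $k$-th eigenvalue of the scalar problem $$\ddot y+\lambda y=0\ \text{ on }[0,T],\qquad y(0)=0,\qquad \cos(\theta)\,y(T)+\sin(\theta)\,\dot y(T)=0 .$$ Then $$\sum_{k\in\mathbb N}\frac1{\lambda_k}=\frac{3T^2\sin(\theta)+T^3\cos(\theta)}{6(\sin(\theta)+T\cos(\theta))}.$$
   Context: An eigenvalue is a number $\lambda$ for which the boundary value problem has a nontrivial solution $y$; the eigenvalues are listed in increasing order. For $\theta\in[0,\pi/2)$, $\lambda_k$ is the $k$-th positive solution of $\tan(\sqrt{\lambda}\,T)=-\tan(\theta)\sqrt{\lambda}$; for $\theta=\pi/2$, $\lambda_k=\frac{\pi^2}{T^2}(k-\frac12)^2$. *)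

theory Defs
  imports "HOL-Analysis.Analysis"
begin

text \<open>Classical solutions: at the end points of \<open>[0, T]\<close> the derivatives are one-sided.
  For \<open>T > 0\<close>, \<open>y'\<close> and \<open>y''\<close> are determined by \<open>y\<close> on \<open>[0, T]\<close>.\<close>

definition bvp_solution :: "real \<Rightarrow> real \<Rightarrow> real \<Rightarrow> (real \<Rightarrow> real) \<Rightarrow> bool" where
  "bvp_solution T \<theta> l y \<longleftrightarrow>
    (\<exists>y' y''.
      (\<forall>t\<in>{0..T}. (y has_real_derivative y' t) (at t within {0..T})) \<and>
      (\<forall>t\<in>{0..T}. (y' has_real_derivative y'' t) (at t within {0..T})) \<and>
      (\<forall>t\<in>{0..T}. y'' t + l * y t = 0) \<and>
      y 0 = 0 \<and>
      cos \<theta> * y T + sin \<theta> * y' T = 0)"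

definition bvp_eigenvalue :: "real \<Rightarrow> real \<Rightarrow> real \<Rightarrow> bool" where
  "bvp_eigenvalue T \<theta> l \<longleftrightarrow> (\<exists>y. bvp_solution T \<theta> l y \<and> (\<exists>t\<in>{0..T}. y t \<noteq> 0))"

text \<open>The \<open>k\<close>-th eigenvalue in increasing order, counted from \<open>k = 1\<close>. Multiplicities play no
  role, since \<open>y 0 = 0\<close> makes every eigenspace one-dimensional. The finiteness condition is
  there because \<^const>\<open>card\<close> of an infinite set is \<open>0\<close>.\<close>

definition kth_eigenvalue :: "real \<Rightarrow> real \<Rightarrow> nat \<Rightarrow> real" where
  "kth_eigenvalue T \<theta> k =
    (THE l. bvp_eigenvalue T \<theta> l \<and>
      finite {m. bvp_eigenvalue T \<theta> m \<and> m < l} \<and>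
      card {m. bvp_eigenvalue T \<theta> m \<and> m < l} + 1 = k)"

end

theory Submission
  imports Defs "HOL-Computational_Algebra.Polynomial" "HOL-Real_Asymp.Real_Asymp"
begin

text \<open>Write \<open>A = T cos \<theta>\<close> and \<open>B = sin \<theta>\<close>, so that \<open>A, B \<ge> 0\<close> and \<open>A + B > 0\<close>. A solution with
  \<open>y 0 = 0\<close> is a multiple of one fundamental solution, so the eigenvalues are the numbers
  \<open>(u / T)\<^sup>2\<close>, where \<open>u\<close> runs through the positive roots of \<open>A sin u + B u cos u\<close>
  (\<open>bvp_eigenvalue_iff\<close>). Each interval \<open>[k \<pi> + \<pi> / 2, k \<pi> + \<pi>]\<close> contains exactly one such root
  \<open>u\<^sub>k\<close>, and there are no others, which identifies the eigenvalue with index \<open>k + 1\<close> as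
  \<open>(u\<^sub>k / T)\<^sup>2\<close> (\<open>ex_ordered_eigenvalues\<close>).

  Formally, the power series \<open>A sin u / u + B cos u = (A + B) - (A / 6 + B / 2) u\<^sup>2 + \<dots>\<close>,
  read as a polynomial in \<open>u\<^sup>2\<close> with roots \<open>u\<^sub>k\<^sup>2\<close>, gives by Vieta's formula
  \<open>\<Sum>\<^sub>k 1 / u\<^sub>k\<^sup>2 = (A / 6 + B / 2) / (A + B)\<close>, which is the claim. To make Euler's argument
  rigorous without the product theorem for entire functions, the series is replaced by genuine
  polynomials. For odd \<open>n = 2 m + 1\<close> put \<open>w(x) = n tan (x / n)\<close>, which tends to \<open>x\<close>. With
  \<open>\<phi> = x / n\<close>, the multiple angle formulas turn \<open>A sin x + B w(x) cos x\<close> into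
  \<open>w(x) cos\<^sup>n \<phi>\<close> times a polynomial of degree at most \<open>m\<close> in \<open>tan\<^sup>2 \<phi>\<close>. The intermediate
  value theorem gives one root \<open>x\<^sub>k\<close> in each of the first \<open>m\<close> intervals, so these are all the
  roots of that polynomial and Vieta's formula evaluates \<open>\<Sum>\<^sub>k 1 / w(x\<^sub>k)\<^sup>2\<close> exactly
  (\<open>ex_approx_roots\<close>). As \<open>m\<close> grows, \<open>x\<^sub>k\<close> and \<open>w(x\<^sub>k)\<close> converge to \<open>u\<^sub>k\<close>, and since
  \<open>w(x\<^sub>k) \<ge> x\<^sub>k \<ge> k + 1\<close>, Tannery's theorem allows taking the limit inside the sum
  (\<open>sum_inverse_square_roots\<close>).\<close>

section \<open>The characteristic equation\<close>

text \<open>Uniqueness for the initial value problem follows from conservation laws: the Wronskian of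
  \<open>y\<close> and \<open>\<phi>\<close>, the mixed energy \<open>y' \<phi>' + l y \<phi>\<close> and the energy of \<open>\<phi>\<close> are all constant,
  and the three identities can be solved for \<open>y\<close> and \<open>y'\<close>. This covers every sign of \<open>l\<close>.\<close>

lemma solution_multiple_of_fundamental:
  fixes y y' \<phi> \<phi>' :: "real \<Rightarrow> real"
  assumes y: "\<And>t. t \<in> {0..T} \<Longrightarrow> (y has_real_derivative y' t) (at t within {0..T})"
    and y': "\<And>t. t \<in> {0..T} \<Longrightarrow> (y' has_real_derivative - l * y t) (at t within {0..T})"
    and \<phi>: "\<And>t. (\<phi> has_real_derivative \<phi>' t) (at t)"
    and \<phi>': "\<And>t. (\<phi>' has_real_derivative - l * \<phi> t) (at t)"
    and init: "y 0 = 0" "\<phi> 0 = 0" "\<phi>' 0 = 1"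
    and t: "t \<in> {0..T}"
  shows "y t = y' 0 * \<phi> t" and "y' t = y' 0 * \<phi>' t" and "\<phi>' t ^ 2 + l * \<phi> t ^ 2 = 1"
proof -
  note d = y y' DERIV_subset[OF \<phi> subset_UNIV] DERIV_subset[OF \<phi>' subset_UNIV]
  have const: "f t = f 0"
    if "\<And>s. s \<in> {0..T} \<Longrightarrow> (f has_real_derivative 0) (at s within {0..T})" for f
  proof -
    have "\<exists>c. \<forall>s\<in>{0..T}. f s = c"
      using that by (intro has_field_derivative_zero_constant) auto
    then show ?thesis
      using t by auto
  qed
  have w: "y t * \<phi>' t - y' t * \<phi> t = 0"
    using const[of "\<lambda>s. y s * \<phi>' s - y' s * \<phi> s"] init
    by (force intro!: derivative_eq_intros d simp: algebra_simps)
  have c: "y' t * \<phi>' t + l * y t * \<phi> t = y' 0"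
    using const[of "\<lambda>s. y' s * \<phi>' s + l * y s * \<phi> s"] init
    by (force intro!: derivative_eq_intros d simp: algebra_simps)
  show e: "\<phi>' t ^ 2 + l * \<phi> t ^ 2 = 1"
    using const[of "\<lambda>s. \<phi>' s ^ 2 + l * \<phi> s ^ 2"] init
    by (force intro!: derivative_eq_intros d simp: algebra_simps)
  show "y t = y' 0 * \<phi> t" "y' t = y' 0 * \<phi>' t"
    using w c e by algebra+
qed

lemma bvp_eigenvalue_iff_fundamental:
  fixes \<phi> \<phi>' :: "real \<Rightarrow> real"
  assumes T: "T > 0"
    and \<phi>: "\<And>t. (\<phi> has_real_derivative \<phi>' t) (at t)"
    and \<phi>': "\<And>t. (\<phi>' has_real_derivative - l * \<phi> t) (at t)"
    and init: "\<phi> 0 = 0" "\<phi>' 0 = 1"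
  shows "bvp_eigenvalue T \<theta> l \<longleftrightarrow> cos \<theta> * \<phi> T + sin \<theta> * \<phi>' T = 0"
proof
  assume "bvp_eigenvalue T \<theta> l"
  then obtain y y' y'' s where y: "\<forall>t\<in>{0..T}. (y has_real_derivative y' t) (at t within {0..T})"
    "\<forall>t\<in>{0..T}. (y' has_real_derivative y'' t) (at t within {0..T})"
    "\<forall>t\<in>{0..T}. y'' t + l * y t = 0" "y 0 = 0" "cos \<theta> * y T + sin \<theta> * y' T = 0"
    and s: "s \<in> {0..T}" "y s \<noteq> 0"
    unfolding bvp_eigenvalue_def bvp_solution_def by blast
  have y'': "y'' t = - l * y t" if "t \<in> {0..T}" for t
    using y(3) that by (auto simp: eq_neg_iff_add_eq_0)
  have mult: "y t = y' 0 * \<phi> t \<and> y' t = y' 0 * \<phi>' t" if "t \<in> {0..T}" for t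
    using solution_multiple_of_fundamental(1,2)[of T y y' l \<phi> \<phi>' t] y y'' \<phi> \<phi>' init that
    by auto
  have "y' 0 * (cos \<theta> * \<phi> T + sin \<theta> * \<phi>' T) = 0"
    using y(5) mult[of T] T by (simp add: algebra_simps)
  moreover have "y' 0 \<noteq> 0"
    using mult[of s] s by auto
  ultimately show "cos \<theta> * \<phi> T + sin \<theta> * \<phi>' T = 0"
    by simp
next
  assume bc: "cos \<theta> * \<phi> T + sin \<theta> * \<phi>' T = 0"
  have "bvp_solution T \<theta> l \<phi>"
    unfolding bvp_solution_def
    by (rule exI[of _ \<phi>'], rule exI[of _ "\<lambda>t. - l * \<phi> t"])
      (auto intro: DERIV_subset[OF \<phi>] DERIV_subset[OF \<phi>'[simplified]] simp: init bc)
  moreover have "\<exists>t\<in>{0..T}. \<phi> t \<noteq> 0"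
  proof (rule ccontr)
    assume zero: "\<not> ?thesis"
    \<comment> \<open>A vanishing \<open>\<phi>\<close> has zero energy at a point where \<open>\<phi>\<close> and \<open>\<phi>'\<close> both vanish, but its energy is \<open>1\<close>.\<close>
    obtain s where s: "0 < s" "s < T" "\<phi> T - \<phi> 0 = (T - 0) * \<phi>' s"
      using MVT2[OF T, of \<phi> \<phi>'] \<phi> by blast
    have "\<phi> T = 0" "\<phi> s = 0"
      using zero T s by auto
    moreover have "\<phi>' s ^ 2 + l * \<phi> s ^ 2 = 1"
      using solution_multiple_of_fundamental(3)[of T \<phi> \<phi>' l \<phi> \<phi>' s] s init \<phi> \<phi>'
      by (auto intro: DERIV_subset)
    ultimately show False
      using s T init by simp
  qed
  ultimately show "bvp_eigenvalue T \<theta> l"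
    unfolding bvp_eigenvalue_def by blast
qed

lemma robin_coeffs:
  assumes "T > 0" "0 \<le> \<theta>" "\<theta> \<le> pi / 2"
  shows "0 \<le> T * cos \<theta>" "0 \<le> sin \<theta>" "T * cos \<theta> + sin \<theta> > 0"
proof -
  show *: "0 \<le> T * cos \<theta>" "0 \<le> sin \<theta>"
    using assms by (auto intro!: mult_nonneg_nonneg cos_ge_zero sin_ge_zero)
  have "T * cos \<theta> \<noteq> 0 \<or> sin \<theta> \<noteq> 0"
    using assms(1) sin_zero_abs_cos_one[of \<theta>] by auto
  then show "T * cos \<theta> + sin \<theta> > 0"
    using * by linarith
qed

text \<open>The fundamental solution is \<open>sin (\<mu> t) / \<mu>\<close>, \<open>t\<close> or \<open>sinh (\<mu> t) / \<mu>\<close>, according to the sign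
  of \<open>l = \<plusminus>\<mu>\<^sup>2\<close>. In the last two cases it and its derivative are positive at \<open>T\<close>, so the
  boundary condition fails. Multiplying the condition by \<open>u = \<mu> T\<close> in the first case gives the
  stated equation, whose extra root \<open>u = 0\<close> is excluded by \<open>u > 0\<close>.\<close>

lemma bvp_eigenvalue_iff:
  assumes T: "T > 0" and \<theta>: "0 \<le> \<theta>" "\<theta> \<le> pi / 2"
  shows "bvp_eigenvalue T \<theta> l \<longleftrightarrow>
    (\<exists>u>0. l = (u / T) ^ 2 \<and> T * cos \<theta> * sin u + sin \<theta> * u * cos u = 0)"
proof -
  note AB = robin_coeffs[OF assms]
  have pos: "cos \<theta> * a + sin \<theta> * b > 0" if "a > 0" "b > 0" for a b
  proof -
    have "cos \<theta> \<ge> 0" "cos \<theta> > 0 \<or> sin \<theta> > 0"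
      using AB T by (auto simp: zero_le_mult_iff) (smt (verit) AB mult_eq_0_iff)
    then show ?thesis
      using that AB(2) by (auto intro: add_pos_nonneg add_nonneg_pos)
  qed
  consider "l > 0" | "l = 0" | "l < 0" by linarith
  then show ?thesis
  proof cases
    case 1
    define \<mu> where "\<mu> = sqrt l"
    have \<mu>: "\<mu> > 0" "l = \<mu> ^ 2"
      using 1 by (auto simp: \<mu>_def)
    have "bvp_eigenvalue T \<theta> l \<longleftrightarrow> cos \<theta> * (sin (\<mu> * T) / \<mu>) + sin \<theta> * cos (\<mu> * T) = 0"
      by (rule bvp_eigenvalue_iff_fundamental[OF T])
        (use \<mu> in \<open>auto intro!: derivative_eq_intros simp: field_simps power2_eq_square\<close>)
    also have "\<dots> \<longleftrightarrow> T * cos \<theta> * sin (\<mu> * T) + sin \<theta> * (\<mu> * T) * cos (\<mu> * T) = 0"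
    proof -
      have "T * cos \<theta> * sin (\<mu> * T) + sin \<theta> * (\<mu> * T) * cos (\<mu> * T)
          = (\<mu> * T) * (cos \<theta> * (sin (\<mu> * T) / \<mu>) + sin \<theta> * cos (\<mu> * T))"
        using \<mu> by (simp add: field_simps)
      then show ?thesis
        using \<mu> T by auto
    qed
    also have "\<dots> \<longleftrightarrow> (\<exists>u>0. l = (u / T) ^ 2 \<and> T * cos \<theta> * sin u + sin \<theta> * u * cos u = 0)"
      (is "_ \<longleftrightarrow> ?R")
    proof
      assume "T * cos \<theta> * sin (\<mu> * T) + sin \<theta> * (\<mu> * T) * cos (\<mu> * T) = 0"
      then show ?R
        using \<mu> T by (intro exI[of _ "\<mu> * T"]) auto
    next
      assume ?R
      then obtain u where u: "u > 0" "l = (u / T) ^ 2" "T * cos \<theta> * sin u + sin \<theta> * u * cos u = 0"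
        by blast
      have "\<mu> = u / T"
        using u T by (simp add: \<mu>_def)
      then show "T * cos \<theta> * sin (\<mu> * T) + sin \<theta> * (\<mu> * T) * cos (\<mu> * T) = 0"
        using u T by simp
    qed
    finally show ?thesis .
  next
    case 2
    have "bvp_eigenvalue T \<theta> l \<longleftrightarrow> cos \<theta> * T + sin \<theta> * 1 = 0"
      by (rule bvp_eigenvalue_iff_fundamental[OF T, of "\<lambda>t. t" "\<lambda>t. 1"])
        (auto intro!: derivative_eq_intros simp: 2)
    moreover have "\<not> (\<exists>u>0. l = (u / T) ^ 2)"
      using 2 T by auto
    ultimately show ?thesis
      using pos[of T 1] T by auto
  next
    case 3
    define \<mu> where "\<mu> = sqrt (- l)"
    have \<mu>: "\<mu> > 0" "l = - (\<mu> ^ 2)"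
      using 3 by (auto simp: \<mu>_def)
    have "bvp_eigenvalue T \<theta> l \<longleftrightarrow> cos \<theta> * (sinh (\<mu> * T) / \<mu>) + sin \<theta> * cosh (\<mu> * T) = 0"
      by (rule bvp_eigenvalue_iff_fundamental[OF T])
        (use \<mu> in \<open>auto intro!: derivative_eq_intros simp: field_simps power2_eq_square\<close>)
    moreover have "\<not> (\<exists>u>0. l = (u / T) ^ 2)"
      using 3 by (metis not_less zero_le_power2)
    ultimately show ?thesis
      using pos[of "sinh (\<mu> * T) / \<mu>" "cosh (\<mu> * T)"] \<mu> T by auto
  qed
qed

section \<open>Location of the roots\<close>

definition cell :: "nat \<Rightarrow> real set" where
  "cell k = {real k * pi + pi / 2 .. real k * pi + pi}"

lemma cell_ge: "x \<in> cell k \<Longrightarrow> real (Suc k) \<le> x"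
  using mult_left_mono[of 1 pi "real k"] pi_gt3 by (auto simp: cell_def)

lemma cell_pos: "x \<in> cell k \<Longrightarrow> x > 0"
  using cell_ge[of x k] by simp

lemma boundary_function_shift:
  "A * sin (real k * pi + y) + B * w * cos (real k * pi + y)
    = (- 1) ^ k * (A * sin y + B * w * cos y)" for A B w y :: real
  by (simp add: sin_add cos_add algebra_simps)

text \<open>The weight \<open>w\<close> is kept general because the lemma serves both the limit equation, where
  \<open>w x = x\<close>, and its trigonometric approximations. At the left end of a cell only the sine
  term survives and at the right end only the cosine term, with opposite signs. The cells are
  closed since the root sits at an end point when \<open>A = 0\<close> or \<open>B = 0\<close>.\<close>

lemma ex_root_in_cell:
  fixes w :: "real \<Rightarrow> real"
  assumes AB: "A \<ge> 0" "B \<ge> 0"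
    and w: "continuous_on (cell k) w" "\<And>x. x \<in> cell k \<Longrightarrow> w x > 0"
  obtains x where "x \<in> cell k" "A * sin x + B * w x * cos x = 0"
proof -
  define g where "g y = A * sin y + B * w (real k * pi + y) * cos y" for y
  have "continuous_on {pi / 2..pi} (\<lambda>y. w (real k * pi + y))"
    by (rule continuous_on_compose2[OF w(1)]) (auto intro!: continuous_intros simp: cell_def)
  then have "continuous_on {pi / 2..pi} g"
    unfolding g_def by (intro continuous_intros)
  moreover have "g pi \<le> 0" "g (pi / 2) \<ge> 0"
    using AB w(2)[of "real k * pi + pi"] by (auto simp: g_def cell_def)
  ultimately obtain y where "pi / 2 \<le> y" "y \<le> pi" "g y = 0"
    using IVT2'[of g pi 0 "pi / 2"] by auto
  then show ?thesis
    using that[of "real k * pi + y"] boundary_function_shift[of A k y B "w (real k * pi + y)"]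
    by (auto simp: g_def cell_def)
qed

text \<open>Modulo the shift by \<open>k \<pi>\<close>, both \<open>sin y\<close> and \<open>x cos y\<close> decrease strictly on
  \<open>[\<pi> / 2, \<pi>]\<close>, where the cosine is nonpositive.\<close>

lemma root_in_cell_unique:
  assumes AB: "A \<ge> 0" "B \<ge> 0" "A + B > 0"
    and a: "a \<in> cell k" "A * sin a + B * a * cos a = 0"
    and b: "b \<in> cell k" "A * sin b + B * b * cos b = 0"
  shows "a = b"
proof -
  have less: False
    if "a < b" and a: "a \<in> cell k" "A * sin a + B * a * cos a = 0"
      and b: "b \<in> cell k" "A * sin b + B * b * cos b = 0" for a b
  proof -
    define y z where "y = a - real k * pi" and "z = b - real k * pi"
    have yz: "pi / 2 \<le> y" "y < z" "z \<le> pi"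
      using that by (auto simp: y_def z_def cell_def)
    have e: "A * sin y + B * a * cos y = 0" "A * sin z + B * b * cos z = 0"
      using boundary_function_shift[of A k y B a] boundary_function_shift[of A k z B b] a b by (auto simp: y_def z_def)
    have pos: "a > 0"
      using a(1) by (rule cell_pos)
    have c: "cos z < cos y" "cos z \<le> 0"
      using yz cos_monotone_0_pi[of y z] cos_monotone_0_pi_le[of "pi/2" z] by auto
    have s: "sin z < sin y"
      using yz sin_monotone_2pi[of "pi - z" "pi - y"] by auto
    have "b * cos z \<le> a * cos z"
      using that(1) c(2) by (intro mult_right_mono_neg) auto
    also have "\<dots> < a * cos y"
      using c(1) pos by simp
    finally have "b * cos z < a * cos y" .
    moreover have "A > 0 \<or> B > 0"
      using AB by linarith
    ultimately have "B * (b * cos z) \<le> B * (a * cos y)" "A * sin z \<le> A * sin y"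
      "A * sin z < A * sin y \<or> B * (b * cos z) < B * (a * cos y)"
      using AB s by (auto intro: mult_left_mono)
    then show False
      using e by (auto simp: mult.assoc)
  qed
  show ?thesis
    using less[of a b] less[of b a] a b by (cases a b rule: linorder_cases) auto
qed

text \<open>Off the cells the sine and the cosine have the same sign, so the two terms cannot cancel.
  The only root with \<open>y = u - k \<pi>\<close> in \<open>[0, \<pi> / 2)\<close> has \<open>B = 0\<close> and \<open>y = 0\<close>, and it is the right
  end point of the preceding cell.\<close>

lemma positive_root_in_cell:
  assumes AB: "A \<ge> 0" "B \<ge> 0" "A + B > 0"
    and u: "u > 0" "A * sin u + B * u * cos u = 0"
  obtains k where "u \<in> cell k"
proof -
  define k where "k = nat \<lfloor>u / pi\<rfloor>"
  define y where "y = u - real k * pi"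
  have "real k \<le> u / pi" "u / pi < real k + 1"
    using u by (auto simp: k_def)
  then have y: "0 \<le> y" "y < pi"
    by (auto simp: y_def field_simps)
  show ?thesis
  proof (cases "y < pi / 2")
    case False
    then show ?thesis
      using that[of k] y by (auto simp: cell_def y_def)
  next
    case True
    have "A * sin y + B * u * cos y = 0"
      using boundary_function_shift[of A k y B u] u by (auto simp: y_def)
    moreover have "cos y > 0" "sin y \<ge> 0"
      using y True by (auto intro: cos_gt_zero_pi sin_ge_zero)
    ultimately have "A * sin y = 0" "B * u * cos y = 0"
      using AB u by (smt (verit) mult_nonneg_nonneg)+
    then have "sin y = 0"
      using AB u \<open>cos y > 0\<close> by auto
    then have "y = 0"
      using y sin_gt_zero[of y] by (cases "y = 0") auto
    then have "u = real k * pi" "k \<noteq> 0"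
      using u by (auto simp: y_def intro: gr0I)
    then show ?thesis
      using that[of "k - 1"] by (cases k) (auto simp: cell_def algebra_simps)
  qed
qed

lemma cell_less:
  assumes "a \<in> cell j" "b \<in> cell k" "j < k"
  shows "a < b"
proof -
  have "real (Suc j) * pi \<le> real k * pi"
    using assms(3) by (intro mult_right_mono) auto
  moreover have "a \<le> real (Suc j) * pi" "real k * pi + pi / 2 \<le> b"
    using assms(1,2) by (auto simp: cell_def algebra_simps)
  ultimately show ?thesis
    using pi_gt_zero by linarith
qed

section \<open>Polynomial approximation of the characteristic equation\<close>

lemma coeff_1_prod_linear:
  fixes r :: "'i \<Rightarrow> 'a :: field"
  assumes "finite K" "\<And>k. k \<in> K \<Longrightarrow> r k \<noteq> 0"
  shows "coeff (\<Prod>k\<in>K. [:- r k, 1:]) 1 = - (\<Sum>k\<in>K. 1 / r k) * coeff (\<Prod>k\<in>K. [:- r k, 1:]) 0"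
  using assms by (induction K rule: finite_induct) (auto simp: field_simps)

text \<open>Vieta's formula for the two lowest coefficients. Bounding the degree by the number of known
  roots suffices: rescale \<open>p\<close> and \<open>q = \<Prod>\<^sub>k (X - r\<^sub>k)\<close> to a common value at \<open>0\<close>; the difference
  also vanishes at \<open>0\<close>, hence has more roots than its degree permits. So the leading
  coefficient of \<open>p\<close> never has to be computed.\<close>

lemma sum_inverse_roots:
  fixes p :: "'a :: field poly"
  assumes K: "finite K" "inj_on r K" "\<And>k. k \<in> K \<Longrightarrow> r k \<noteq> 0"
    and p: "degree p \<le> card K" "\<And>k. k \<in> K \<Longrightarrow> poly p (r k) = 0" "coeff p 0 \<noteq> 0"
  shows "(\<Sum>k\<in>K. 1 / r k) = - coeff p 1 / coeff p 0"
proof -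
  define q where "q = (\<Prod>k\<in>K. [:- r k, 1:])"
  define d where "d = smult (coeff q 0) p - smult (coeff p 0) q"
  have q: "degree q \<le> card K" "coeff q 0 \<noteq> 0" "\<And>k. k \<in> K \<Longrightarrow> poly q (r k) = 0"
    using K degree_prod_sum_le[OF K(1), of "\<lambda>k. [:- r k, 1:]"]
    by (auto simp: q_def poly_prod simp flip: poly_0_coeff_0)
  have "d = 0"
  proof (rule ccontr)
    assume "d \<noteq> 0"
    have "insert 0 (r ` K) \<subseteq> {x. poly d x = 0}"
      using p q by (auto simp: d_def poly_0_coeff_0)
    then have "card (insert 0 (r ` K)) \<le> card {x. poly d x = 0}"
      using \<open>d \<noteq> 0\<close> by (intro card_mono poly_roots_finite)
    also have "\<dots> \<le> degree d"
      using \<open>d \<noteq> 0\<close> by (rule card_poly_roots_bound)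
    also have "\<dots> \<le> card K"
      unfolding d_def using p(1) q(1) by (intro degree_diff_le) (auto intro: order.trans[OF degree_smult_le])
    finally show False
      using K by (subst (asm) card_insert_disjoint) (auto simp: card_image)
  qed
  then have "coeff q 0 * coeff p 1 = coeff p 0 * coeff q 1"
    by (metis d_def coeff_smult eq_iff_diff_eq_0)
  also have "coeff q 1 = - (\<Sum>k\<in>K. 1 / r k) * coeff q 0"
    unfolding q_def using K by (intro coeff_1_prod_linear) auto
  finally have "coeff q 0 * coeff p 1 = coeff q 0 * (- (\<Sum>k\<in>K. 1 / r k) * coeff p 0)"
    by (simp add: mult_ac)
  then have "coeff p 1 = - (\<Sum>k\<in>K. 1 / r k) * coeff p 0"
    using q(2) by (simp only: mult_left_cancel[OF q(2)])
  then show ?thesis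
    using p(3) by simp
qed

text \<open>With \<open>X = tan\<^sup>2 \<phi>\<close>, the two components are \<open>cos (n \<phi>) / cos\<^sup>n \<phi>\<close> and
  \<open>sin (n \<phi>) / (cos\<^sup>n \<phi> tan \<phi>)\<close>, that is, the even and odd parts of the binomial expansion of
  \<open>(1 + i tan \<phi>)\<^sup>n\<close>. The recursion is the addition theorem for \<open>n \<phi> + \<phi>\<close>.\<close>

primrec multiple_angle :: "nat \<Rightarrow> real poly \<times> real poly" where
  "multiple_angle 0 = (1, 0)"
| "multiple_angle (Suc n) = (let (c, s) = multiple_angle n in (c - pCons 0 s, s + c))"

lemma multiple_angle:
  fixes \<phi> :: real
  assumes "cos \<phi> \<noteq> 0"
  shows "cos (real n * \<phi>) = cos \<phi> ^ n * poly (fst (multiple_angle n)) (tan \<phi> ^ 2)"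
    and "sin (real n * \<phi>) = cos \<phi> ^ n * (tan \<phi> * poly (snd (multiple_angle n)) (tan \<phi> ^ 2))"
proof (induction n)
  case (Suc n)
  have s: "sin \<phi> = cos \<phi> * tan \<phi>"
    using assms by (simp add: tan_def)
  case 1
  show ?case
    using Suc by (simp add: distrib_right cos_add split_beta Let_def s algebra_simps power2_eq_square)
  case 2
  show ?case
    using Suc by (simp add: distrib_right sin_add split_beta Let_def s algebra_simps power2_eq_square)
qed auto

lemma coeff_multiple_angle:
  shows "coeff (fst (multiple_angle n)) 0 = 1"
    and "coeff (snd (multiple_angle n)) 0 = real n"
    and "coeff (fst (multiple_angle n)) 1 = - (real n * (real n - 1) / 2)"
    and "coeff (snd (multiple_angle n)) 1 = - (real n * (real n - 1) * (real n - 2) / 6)"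
proof (induction n)
  case (Suc n)
  case 1 show ?case using Suc by (simp add: split_beta Let_def)
  case 2 show ?case using Suc by (simp add: split_beta Let_def)
  case 3 show ?case using Suc by (simp add: split_beta Let_def field_simps)
  case 4 show ?case using Suc by (simp add: split_beta Let_def field_simps)
qed auto

lemma coeff_multiple_angle_eq_0:
  shows "n < 2 * j \<Longrightarrow> coeff (fst (multiple_angle n)) j = 0"
    and "n < 2 * j + 1 \<Longrightarrow> coeff (snd (multiple_angle n)) j = 0"
proof (induction n arbitrary: j)
  case (Suc n)
  {
    case 1
    then show ?case
      using Suc by (cases j) (auto simp: split_beta Let_def)
  next
    case 2
    then show ?case
      using Suc by (auto simp: split_beta Let_def)
  }
qed (auto simp: coeff_eq_0)

text \<open>The odd multiplier \<open>2 m + 1\<close> makes both components of \<^term>\<open>multiple_angle (2 * m + 1)\<close>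
  polynomials of degree at most \<open>m\<close>, the number of cells inside \<open>(0, (2 m + 1) \<pi> / 2)\<close>.\<close>

definition tan_scale :: "nat \<Rightarrow> real \<Rightarrow> real" where
  "tan_scale m x = (2 * real m + 1) * tan (x / (2 * real m + 1))"

lemma tan_minus_id_mono:
  assumes "0 \<le> a" "a \<le> b" "b < pi / 2"
  shows "tan a - a \<le> tan b - b"
proof (rule DERIV_nonneg_imp_nondecreasing[OF assms(2)])
  fix x assume x: "a \<le> x" "x \<le> b"
  then have c: "cos x > 0"
    using assms by (intro cos_gt_zero_pi) auto
  have "((\<lambda>x. tan x - x) has_real_derivative inverse ((cos x)\<^sup>2) - 1) (at x)"
    using c by (auto intro!: derivative_eq_intros)
  moreover have "inverse ((cos x)\<^sup>2) \<ge> 1"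
    using c by (intro one_le_inverse) (auto simp: abs_square_le_1)
  ultimately show "\<exists>y. ((\<lambda>x. tan x - x) has_real_derivative y) (at x) \<and> 0 \<le> y"
    by force
qed

lemma cell_angle_less:
  assumes "x \<in> cell k" "k < m"
  shows "0 < x / (2 * real m + 1)" "x / (2 * real m + 1) < pi / 2"
proof -
  have "real (Suc k) * pi \<le> real m * pi"
    using assms(2) by (intro mult_right_mono) auto
  moreover have "x \<le> real (Suc k) * pi"
    using assms(1) by (auto simp: cell_def algebra_simps)
  moreover have "real m * pi < (2 * real m + 1) * pi / 2"
    by (simp add: field_simps)
  ultimately have "x < (2 * real m + 1) * pi / 2"
    by linarith
  then show "x / (2 * real m + 1) < pi / 2"
    by (simp add: field_simps)
  show "0 < x / (2 * real m + 1)"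
    using cell_pos[OF assms(1)] by simp
qed

lemma tan_scale_ge:
  assumes "x \<in> cell k" "k < m"
  shows "x \<le> tan_scale m x"
proof -
  have "x / (2 * real m + 1) \<le> tan (x / (2 * real m + 1))"
    using tan_minus_id_mono[of 0 "x / (2 * real m + 1)"] cell_angle_less[OF assms] by auto
  then show ?thesis
    by (simp add: tan_scale_def field_simps)
qed

lemma continuous_on_tan_scale:
  assumes "k < m"
  shows "continuous_on (cell k) (tan_scale m)"
  unfolding tan_scale_def
proof (intro continuous_intros ballI)
  fix x assume "x \<in> cell k"
  from cell_angle_less[OF this assms] show "cos (x / (2 * real m + 1)) \<noteq> 0"
    using cos_gt_zero_pi[of "x / (2 * real m + 1)"] by auto
qed auto

text \<open>The \<open>m\<close> roots supplied by the cells exhaust the degree of the polynomial \<open>p\<close> in \<open>tan\<^sup>2 \<phi>\<close>, so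
  the sum of their inverses is determined by the two lowest coefficients of \<open>p\<close>.\<close>

lemma ex_approx_roots:
  assumes AB: "A \<ge> 0" "B \<ge> 0" "A + B > 0"
  obtains x where
    "\<And>k. k < m \<Longrightarrow> x k \<in> cell k"
    "\<And>k. k < m \<Longrightarrow> A * sin (x k) + B * tan_scale m (x k) * cos (x k) = 0"
    "(\<Sum>k<m. 1 / tan_scale m (x k) ^ 2) =
      (A * (2 * real m) * (2 * real m - 1) / 6 + B * (2 * real m) * (2 * real m + 1) / 2)
        / ((2 * real m + 1) ^ 2 * (A + B))"
proof -
  define n where "n = 2 * m + 1"
  have n: "real n = 2 * real m + 1" "real n > 0"
    by (auto simp: n_def)
  have "\<exists>y. y \<in> cell k \<and> A * sin y + B * tan_scale m y * cos y = 0" if "k < m" for k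
    using ex_root_in_cell[of A B k "tan_scale m"] AB continuous_on_tan_scale[OF that]
      less_le_trans[OF cell_pos tan_scale_ge[OF _ that]] by metis
  then obtain x where x: "\<And>k. k < m \<Longrightarrow> x k \<in> cell k"
      "\<And>k. k < m \<Longrightarrow> A * sin (x k) + B * tan_scale m (x k) * cos (x k) = 0"
    by metis
  define \<phi> where "\<phi> k = x k / real n" for k
  define r where "r k = tan (\<phi> k) ^ 2" for k
  have wk: "tan_scale m (x k) = real n * tan (\<phi> k)" for k
    unfolding tan_scale_def \<phi>_def n(1) ..
  have \<phi>: "0 < \<phi> k" "\<phi> k < pi / 2" if "k < m" for k
    using cell_angle_less[OF x(1)[OF that] that] by (auto simp: \<phi>_def n)
  have tan_pos: "tan (\<phi> k) > 0" if "k < m" for k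
    using \<phi>[OF that] by (rule tan_gt_zero)
  have r0: "r k \<noteq> 0" if "k < m" for k
    using tan_pos[OF that] by (simp add: r_def)
  have inj: "inj_on r {..<m}"
  proof (rule linorder_inj_onI)
    fix j k assume jk: "j < k" "j \<in> {..<m}" "k \<in> {..<m}"
    have "x j < x k"
      using jk x(1) by (intro cell_less[of _ j _ k]) auto
    then have "\<phi> j < \<phi> k"
      using n by (simp add: \<phi>_def divide_strict_right_mono)
    then have "tan (\<phi> j) < tan (\<phi> k)"
      using \<phi>[of j] \<phi>[of k] jk by (intro tan_monotone) auto
    then have "r j < r k"
      unfolding r_def using tan_pos[of j] jk by (intro power_strict_mono) auto
    then show "r j \<noteq> r k"
      by simp
  qed auto
  define p where "p = smult (A / real n) (snd (multiple_angle n)) + smult B (fst (multiple_angle n))"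
  have "degree p \<le> m"
  proof (intro degree_le allI impI)
    fix i assume "m < i"
    then have "n < 2 * i"
      by (simp add: n_def)
    then show "coeff p i = 0"
      by (simp add: p_def coeff_multiple_angle_eq_0)
  qed
  moreover have "poly p (r k) = 0" if k: "k < m" for k
  proof -
    have c: "cos (\<phi> k) > 0"
      using \<phi>[OF k] by (intro cos_gt_zero_pi) auto
    have xk: "x k = real n * \<phi> k"
      using n(2) by (simp add: \<phi>_def)
    have "cos (\<phi> k) ^ n * (real n * tan (\<phi> k)) * poly p (r k)
        = A * sin (x k) + B * tan_scale m (x k) * cos (x k)"
      unfolding wk unfolding xk multiple_angle[OF less_imp_neq[OF c, symmetric]] p_def r_def
      using n(2) by (simp add: field_simps)
    then show ?thesis
      using x(2)[OF k] c n(2) tan_pos[OF k] by auto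
  qed
  moreover have c0: "coeff p 0 = A + B"
    using n(2) by (simp add: p_def coeff_multiple_angle)
  ultimately have "(\<Sum>k<m. 1 / r k) = - coeff p 1 / coeff p 0"
    using AB(3) inj r0 by (intro sum_inverse_roots) auto
  also have "coeff p 1 = - (A * (2 * real m) * (2 * real m - 1) / 6 + B * (2 * real m) * (2 * real m + 1) / 2)"
  proof -
    have "coeff p 1 = - (A * (real n - 1) * (real n - 2) / 6 + B * real n * (real n - 1) / 2)"
      using n(2) unfolding p_def coeff_add coeff_smult coeff_multiple_angle by (simp add: field_simps)
    moreover have "real n - 1 = 2 * real m" "real n - 2 = 2 * real m - 1"
      by (auto simp: n(1))
    ultimately show ?thesis
      by (simp only: n(1)) (simp add: mult_ac)
  qed
  finally have "(\<Sum>k<m. 1 / r k) / real n ^ 2 =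
      (A * (2 * real m) * (2 * real m - 1) / 6 + B * (2 * real m) * (2 * real m + 1) / 2)
        / (real n ^ 2 * (A + B))"
    by (simp add: c0 mult.commute add.commute)
  also have "(\<Sum>k<m. 1 / r k) / real n ^ 2 = (\<Sum>k<m. 1 / tan_scale m (x k) ^ 2)"
    by (simp add: sum_divide_distrib r_def wk power_mult_distrib mult.commute)
  finally show ?thesis
    using that[of x] x n by simp
qed

section \<open>Passage to the limit\<close>

text \<open>The points \<open>x m\<close> vary with \<open>m\<close>, but \<open>tan a - a\<close> is increasing, so the right end point
  \<open>b\<close> of the cell bounds the error uniformly.\<close>

lemma tan_scale_minus_id_tendsto:
  assumes x: "\<And>m. k < m \<Longrightarrow> x m \<in> cell k"
  shows "(\<lambda>m. tan_scale m (x m) - x m) \<longlonglongrightarrow> 0"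
proof (rule tendsto_sandwich[OF _ _ tendsto_const])
  define b where "b = real k * pi + pi"
  show "\<forall>\<^sub>F m in sequentially. 0 \<le> tan_scale m (x m) - x m"
    using eventually_gt_at_top[of k] by eventually_elim (use tan_scale_ge x in auto)
  show "\<forall>\<^sub>F m in sequentially. tan_scale m (x m) - x m \<le> tan_scale m b - b"
    using eventually_gt_at_top[of k]
  proof eventually_elim
    case (elim m)
    have "b \<in> cell k" "x m \<le> b"
      using x[OF elim] by (auto simp: b_def cell_def)
    define N where "N = 2 * real m + 1"
    have "tan (x m / N) - x m / N \<le> tan (b / N) - b / N"
      unfolding N_def using cell_angle_less(2)[OF \<open>b \<in> cell k\<close> elim] cell_angle_less(1)[OF x[OF elim] elim] \<open>x m \<le> b\<close>
      by (intro tan_minus_id_mono) (auto simp: divide_right_mono)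
    then have "N * (tan (x m / N) - x m / N) \<le> N * (tan (b / N) - b / N)"
      by (intro mult_left_mono) (auto simp: N_def)
    moreover have "N > 0"
      by (simp add: N_def)
    ultimately show ?case
      by (simp add: tan_scale_def right_diff_distrib flip: N_def)
  qed
  show "(\<lambda>m. tan_scale m b - b) \<longlonglongrightarrow> 0"
    unfolding tan_scale_def by real_asymp
qed

text \<open>Away from \<open>u\<close> the norm of \<open>f\<close> has a positive minimum on \<open>K\<close>, which \<open>f (x m)\<close> eventually
  undercuts. This replaces any quantitative estimate of how fast the approximate roots converge.\<close>

lemma tendsto_unique_zero:
  fixes f :: "'a :: metric_space \<Rightarrow> 'b :: real_normed_vector"
  assumes K: "compact K" "continuous_on K f"
    and u: "\<And>x. x \<in> K \<Longrightarrow> f x = 0 \<Longrightarrow> x = u"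
    and x: "\<forall>\<^sub>F m in F. x m \<in> K" "((\<lambda>m. f (x m)) \<longlongrightarrow> 0) F"
  shows "(x \<longlongrightarrow> u) F"
proof (rule tendstoI)
  fix e :: real assume "e > 0"
  define L where "L = K - ball u e"
  have L: "compact L" "continuous_on L (\<lambda>x. norm (f x))"
    using K by (auto simp: L_def intro!: compact_diff continuous_intros intro: continuous_on_subset)
  show "\<forall>\<^sub>F m in F. dist (x m) u < e"
  proof (cases "L = {}")
    case True
    show ?thesis
      using x(1) by eventually_elim (use True in \<open>auto simp: L_def dist_commute\<close>)
  next
    case False
    obtain z where z: "z \<in> L" "\<And>y. y \<in> L \<Longrightarrow> norm (f z) \<le> norm (f y)"
      using continuous_attains_inf[OF L(1) False L(2)] by blast
    have "z \<noteq> u" "z \<in> K"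
      using z(1) \<open>e > 0\<close> by (auto simp: L_def)
    then have "norm (f z) > 0"
      using u[of z] by auto
    then have "\<forall>\<^sub>F m in F. norm (f (x m)) < norm (f z)"
      using tendstoD[OF x(2)] by simp
    then show ?thesis
      using x(1) by eventually_elim (use z(2) in \<open>force simp: L_def dist_commute not_less\<close>)
  qed
qed

lemma compact_cell: "compact (cell k)"
  by (simp add: cell_def)

lemma continuous_on_boundary_function: "continuous_on S (\<lambda>x. A * sin x + B * x * cos x)" for A B :: real
  by (intro continuous_intros)

lemma sum_inverse_square_roots:
  assumes AB: "A \<ge> 0" "B \<ge> 0" "A + B > 0"
    and u: "\<And>k. u k \<in> cell k" "\<And>k. A * sin (u k) + B * u k * cos (u k) = 0"
  shows "(\<lambda>k. 1 / u k ^ 2) sums ((A / 6 + B / 2) / (A + B))"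
proof -
  define s where "s m = (A * (2 * real m) * (2 * real m - 1) / 6 + B * (2 * real m) * (2 * real m + 1) / 2)
        / ((2 * real m + 1) ^ 2 * (A + B))" for m
  have "\<exists>x. (\<forall>k<m. x k \<in> cell k \<and> A * sin (x k) + B * tan_scale m (x k) * cos (x k) = 0) \<and>
      (\<Sum>k<m. 1 / tan_scale m (x k) ^ 2) = s m" for m
    using ex_approx_roots[OF AB, of m] unfolding s_def by metis
  then obtain x where x: "\<And>m k. k < m \<Longrightarrow> x m k \<in> cell k"
      "\<And>m k. k < m \<Longrightarrow> A * sin (x m k) + B * tan_scale m (x m k) * cos (x m k) = 0"
      "\<And>m. (\<Sum>k<m. 1 / tan_scale m (x m k) ^ 2) = s m"
    by metis
  define a where "a k m = (if k < m then 1 / tan_scale m (x m k) ^ 2 else 0)" for k m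
  have lim: "(a k \<longlonglongrightarrow> 1 / u k ^ 2)" for k
  proof -
    have close: "(\<lambda>m. tan_scale m (x m k) - x m k) \<longlonglongrightarrow> 0"
      using x(1) by (intro tan_scale_minus_id_tendsto)
    \<comment> \<open>The approximate root solves the limit equation up to the error of replacing \<open>w\<close> by the identity.\<close>
    have "(\<lambda>m. A * sin (x m k) + B * x m k * cos (x m k)) \<longlonglongrightarrow> 0"
    proof (rule Lim_transform_eventually)
      show "(\<lambda>m. - B * ((tan_scale m (x m k) - x m k) * cos (x m k))) \<longlonglongrightarrow> 0"
        by (intro tendsto_mult_right_zero lim_null_mult_right_bounded[where B = 1] close) auto
      show "\<forall>\<^sub>F m in sequentially. - B * ((tan_scale m (x m k) - x m k) * cos (x m k))
          = A * sin (x m k) + B * x m k * cos (x m k)"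
        using eventually_gt_at_top[of k]
        by eventually_elim (use x(2) in \<open>force simp: algebra_simps\<close>)
    qed
    then have "(\<lambda>m. x m k) \<longlonglongrightarrow> u k"
    proof (rule tendsto_unique_zero[OF compact_cell continuous_on_boundary_function, rotated 2])
      show "\<forall>\<^sub>F m in sequentially. x m k \<in> cell k"
        using eventually_gt_at_top[of k] by eventually_elim (rule x(1))
      show "y = u k" if "y \<in> cell k" "A * sin y + B * y * cos y = 0" for y
        using root_in_cell_unique[OF AB that u] .
    qed
    from tendsto_add[OF close this] have "(\<lambda>m. tan_scale m (x m k)) \<longlonglongrightarrow> u k"
      by simp
    then have "(\<lambda>m. 1 / tan_scale m (x m k) ^ 2) \<longlonglongrightarrow> 1 / u k ^ 2"
      using cell_pos[OF u(1)[of k]] by (intro tendsto_intros) auto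
    then show ?thesis
      by (rule Lim_transform_eventually)
        (use eventually_gt_at_top[of k] in eventually_elim, simp add: a_def)
  qed
  have bound: "norm (a k m) \<le> 1 / real (Suc k) ^ 2" for k m
  proof (cases "k < m")
    case True
    have "real (Suc k) \<le> tan_scale m (x m k)"
      using cell_ge[OF x(1)[OF True]] tan_scale_ge[OF x(1)[OF True] True] by simp
    then show ?thesis
      using True by (auto simp: a_def intro!: divide_left_mono power_mono mult_pos_pos zero_less_power)
  qed (auto simp: a_def)
  have "summable (\<lambda>k. 1 / real (Suc k) ^ 2)"
    using inverse_power_summable[of 2, where 'a = real]
    by (subst summable_Suc_iff[of "\<lambda>k. 1 / real k ^ 2"]) (simp add: inverse_eq_divide)
  then have tannery: "summable (\<lambda>k. norm (1 / u k ^ 2)) \<and> (\<lambda>m. suminf (\<lambda>k. a k m)) \<longlonglongrightarrow> (\<Sum>k. 1 / u k ^ 2)"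
    using tannerys_theorem[where a = a and b = "\<lambda>k. 1 / u k ^ 2" and F = sequentially
        and M = "\<lambda>k. 1 / real (Suc k) ^ 2"] lim bound
    by (auto intro!: always_eventually)
  have "suminf (\<lambda>k. a k m) = s m" for m
    using suminf_finite[of "{..<m}" "\<lambda>k. a k m"] x(3)[of m] by (simp add: a_def)
  moreover have "s \<longlonglongrightarrow> (A / 6 + B / 2) / (A + B)"
  proof -
    have "s \<longlonglongrightarrow> (2 * A / 3 + 2 * B) * inverse (4 * A + 4 * B)"
      unfolding s_def using AB(3) by real_asymp
    also have "(2 * A / 3 + 2 * B) * inverse (4 * A + 4 * B) = (A / 6 + B / 2) / (A + B)"
    proof -
      have "4 * A + 4 * B \<noteq> 0" "A + B \<noteq> 0"
        using AB(3) by auto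
      then show ?thesis
        by (simp add: divide_simps) (simp add: algebra_simps)
    qed
    finally show ?thesis .
  qed
  ultimately have "(\<Sum>k. 1 / u k ^ 2) = (A / 6 + B / 2) / (A + B)"
    using tannery LIMSEQ_unique by auto
  moreover have "summable (\<lambda>k. 1 / u k ^ 2)"
    by (rule summable_norm_cancel[OF conjunct1[OF tannery]])
  ultimately show ?thesis
    by (simp add: sums_iff)
qed

section \<open>The eigenvalues in increasing order\<close>

text \<open>The cells are ordered and each contains one root, so exactly \<open>k\<close> eigenvalues lie below the one
  coming from cell \<open>k\<close>. Cells are numbered from \<open>0\<close> and eigenvalues from \<open>1\<close>.\<close>

lemma ex_ordered_eigenvalues:
  assumes T: "T > 0" and \<theta>: "0 \<le> \<theta>" "\<theta> \<le> pi / 2"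
  obtains u where
    "\<And>k. u k \<in> cell k"
    "\<And>k. T * cos \<theta> * sin (u k) + sin \<theta> * u k * cos (u k) = 0"
    "\<And>k. kth_eigenvalue T \<theta> (Suc k) = (u k / T) ^ 2"
proof -
  define A B where "A = T * cos \<theta>" and "B = sin \<theta>"
  have AB: "A \<ge> 0" "B \<ge> 0" "A + B > 0"
    using robin_coeffs[OF assms] by (auto simp: A_def B_def)
  have "\<exists>x. x \<in> cell k \<and> A * sin x + B * x * cos x = 0" for k
    using ex_root_in_cell[of A B k "\<lambda>x. x"] AB cell_pos by (metis continuous_on_id)
  then obtain u where u: "\<And>k. u k \<in> cell k" "\<And>k. A * sin (u k) + B * u k * cos (u k) = 0"
    by metis
  define ev where "ev k = (u k / T) ^ 2" for k
  have "ev j < ev k" if "j < k" for j k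
    unfolding ev_def using T cell_less[OF u(1) u(1) that] cell_pos[OF u(1)[of j]]
    by (intro power_strict_mono divide_strict_right_mono) auto
  then have ev_mono: "strict_mono ev"
    by (simp add: strict_mono_def)
  have ev_iff: "bvp_eigenvalue T \<theta> l \<longleftrightarrow> l \<in> range ev" for l
  proof
    assume "bvp_eigenvalue T \<theta> l"
    then obtain v where v: "v > 0" "l = (v / T) ^ 2" "A * sin v + B * v * cos v = 0"
      using bvp_eigenvalue_iff[OF assms, of l] by (auto simp: A_def B_def)
    obtain k where "v \<in> cell k"
      using positive_root_in_cell[OF AB v(1,3)] .
    then have "v = u k"
      using root_in_cell_unique[OF AB _ v(3) u] by blast
    then show "l \<in> range ev"
      using v by (auto simp: ev_def)
  next
    assume "l \<in> range ev"
    then show "bvp_eigenvalue T \<theta> l"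
      using bvp_eigenvalue_iff[OF assms, of l] u(2) cell_pos[OF u(1)]
      by (auto simp: ev_def A_def B_def)
  qed
  have below: "{m. bvp_eigenvalue T \<theta> m \<and> m < ev k} = ev ` {..<k}" for k
    using strict_mono_less[OF ev_mono] by (auto simp: ev_iff)
  have card: "card (ev ` {..<k}) = k" for k
    using strict_mono_imp_inj_on[OF ev_mono] by (simp add: card_image inj_on_subset)
  have "kth_eigenvalue T \<theta> (Suc k) = ev k" for k
    unfolding kth_eigenvalue_def
  proof (rule the_equality)
    fix l assume l: "bvp_eigenvalue T \<theta> l \<and> finite {m. bvp_eigenvalue T \<theta> m \<and> m < l} \<and>
      card {m. bvp_eigenvalue T \<theta> m \<and> m < l} + 1 = Suc k"
    then obtain j where "l = ev j"
      using ev_iff by blast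
    with l show "l = ev k"
      by (simp add: below card)
  next
    have "bvp_eigenvalue T \<theta> (ev k)"
      by (simp add: ev_iff)
    then show "bvp_eigenvalue T \<theta> (ev k) \<and> finite {m. bvp_eigenvalue T \<theta> m \<and> m < ev k} \<and>
      card {m. bvp_eigenvalue T \<theta> m \<and> m < ev k} + 1 = Suc k"
      by (simp add: below card)
  qed
  then show ?thesis
    using that[of u] u by (simp add: ev_def A_def B_def)
qed

theorem mainTheorem4:
  fixes T \<theta> :: real
  assumes "T > 0" and "0 \<le> \<theta>" and "\<theta> \<le> pi / 2"
  shows "((\<lambda>k. 1 / kth_eigenvalue T \<theta> k) has_sum
           (3 * T ^ 2 * sin \<theta> + T ^ 3 * cos \<theta>) / (6 * (sin \<theta> + T * cos \<theta>))) {1..}"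
    (is "(_ has_sum ?S) _")
proof -
  note AB = robin_coeffs[OF assms]
  obtain u where u: "\<And>k. u k \<in> cell k"
    "\<And>k. T * cos \<theta> * sin (u k) + sin \<theta> * u k * cos (u k) = 0"
    "\<And>k. kth_eigenvalue T \<theta> (Suc k) = (u k / T) ^ 2"
    using ex_ordered_eigenvalues[OF assms] by blast
  have "(\<lambda>k. T ^ 2 * (1 / u k ^ 2)) sums
      (T ^ 2 * ((T * cos \<theta> / 6 + sin \<theta> / 2) / (T * cos \<theta> + sin \<theta>)))"
    using u(1,2) AB by (intro sums_mult sum_inverse_square_roots)
  also have "T ^ 2 * ((T * cos \<theta> / 6 + sin \<theta> / 2) / (T * cos \<theta> + sin \<theta>)) = ?S"
  proof -
    have "T * cos \<theta> + sin \<theta> \<noteq> 0" "6 * (sin \<theta> + T * cos \<theta>) \<noteq> 0"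
      using AB(3) by auto
    then show ?thesis
      by (simp add: divide_simps) (simp add: algebra_simps power2_eq_square power3_eq_cube)
  qed
  also have "(\<lambda>k. T ^ 2 * (1 / u k ^ 2)) = (\<lambda>k. 1 / kth_eigenvalue T \<theta> (Suc k))"
    by (simp add: u(3) power_divide)
  finally have "((\<lambda>k. 1 / kth_eigenvalue T \<theta> (Suc k)) has_sum ?S) UNIV"
    by (intro sums_nonneg_imp_has_sum) (auto simp: u(3))
  then have "((\<lambda>k. 1 / kth_eigenvalue T \<theta> k) has_sum ?S) (Suc ` UNIV)"
    by (subst has_sum_reindex) (auto simp: o_def)
  also have "Suc ` UNIV = {1..}"
    by (auto simp: image_iff Suc_le_eq gr0_conv_Suc)
  finally show ?thesis .
qed

end
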